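(* Let $(M,\langle\,,\rangle)$ be a Riemannian manifold and let $\mathcal{V}$ be a proper torqued vector field on $M$. Then $\mathcal{V}$ is not of constant length, i.e. the function $|\mathcal{V}|=\langle\mathcal{V},\mathcal{V}\rangle^{1/2}$ is not constant on $M$.
   Context: Let $(M,\langle\,,\rangle)$ be a Riemannian manifold with Levi-Civita connection $\nabla^0$, and let $\mathfrak{X}(M)$ denote the smooth vector fields on $M$. A nowhere zero smooth vector field $\mathcal{V}$ on $M$ is called torse-forming if there are a smooth function $f$ (the conformal scalar) and a $1$-form $\omega$ (the generating form) on $M$ with $\nabla^0_X\mathcal{V}=fX+\omega(X)\mathcal{V}$ for all $X\in\mathfrak{X}(M)$. It is called proper if neither $f$ nor $\omega$ vanishes identically on any nonempty open subset of $M$. A torqued vector field is a torse-forming vector field with $\omega(\mathcal{V})=0$ on $M$. *)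

theory Defs
  imports "HOL-Analysis.Analysis"
begin

section \<open>Smooth maps between open subsets of Euclidean spaces\<close>

text \<open>These two predicates are meant for open sets \<open>S\<close> only: they use the derivative \<open>at x\<close>,
  not \<open>at x within S\<close>.\<close>

primrec Ck_on :: "nat \<Rightarrow> 'e set \<Rightarrow> ('e::euclidean_space \<Rightarrow> 'b::real_normed_vector) \<Rightarrow> bool" where
  "Ck_on 0 S f \<longleftrightarrow> continuous_on S f"
| "Ck_on (Suc k) S f \<longleftrightarrow>
     (\<forall>x\<in>S. f differentiable (at x)) \<and> (\<forall>v. Ck_on k S (\<lambda>x. frechet_derivative f (at x) v))"

definition smooth_on :: "'e set \<Rightarrow> ('e::euclidean_space \<Rightarrow> 'b::real_normed_vector) \<Rightarrow> bool" where
  "smooth_on S f \<longleftrightarrow> (\<forall>k. Ck_on k S f)"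


section \<open>Smooth manifolds\<close>

text \<open>A chart is a pair \<open>(U, \<phi>)\<close> of its domain and its coordinate map. The model space \<open>'e\<close> is an
  arbitrary Euclidean space, whose dimension \<open>DIM('e)\<close> is the dimension of the manifold. The atlas
  need not be maximal.\<close>

record ('a, 'e) manifold =
  mtop :: "'a topology"
  atlas :: "('a set \<times> ('a \<Rightarrow> 'e)) set"

abbreviation points :: "('a, 'e) manifold \<Rightarrow> 'a set" where
  "points M \<equiv> topspace (mtop M)"

definition is_chart :: "'a topology \<Rightarrow> 'a set \<Rightarrow> ('a \<Rightarrow> 'e::euclidean_space) \<Rightarrow> bool" where
  "is_chart X U \<phi> \<longleftrightarrow>
     openin X U \<and> open (\<phi> ` U) \<and>
     homeomorphic_map (subtopology X U) (top_of_set (\<phi> ` U)) \<phi>"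

definition smooth_manifold :: "('a, 'e::euclidean_space) manifold \<Rightarrow> bool" where
  "smooth_manifold M \<longleftrightarrow>
     points M \<noteq> {} \<and> Hausdorff_space (mtop M) \<and> second_countable (mtop M) \<and>
     (\<forall>(U, \<phi>)\<in>atlas M. is_chart (mtop M) U \<phi>) \<and>
     (\<Union>(U, \<phi>)\<in>atlas M. U) = points M \<and>
     (\<forall>(U, \<phi>)\<in>atlas M. \<forall>(W, \<psi>)\<in>atlas M.
        smooth_on (\<phi> ` (U \<inter> W)) (\<lambda>z. \<psi> (inv_into U \<phi> z)))"

text \<open>\<open>C\<^sup>\<infinity>(M)\<close>; functions are total on \<open>'a\<close>, and their values outside \<open>M\<close> are irrelevant.\<close>

definition smooth_fun :: "('a, 'e::euclidean_space) manifold \<Rightarrow> ('a \<Rightarrow> real) \<Rightarrow> bool" where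
  "smooth_fun M h \<longleftrightarrow> (\<forall>(U, \<phi>)\<in>atlas M. smooth_on (\<phi> ` U) (\<lambda>z. h (inv_into U \<phi> z)))"


section \<open>Tangent vectors, vector fields and 1-forms\<close>

text \<open>Tangent vectors at \<open>p\<close> are the derivations of \<open>C\<^sup>\<infinity>(M)\<close> at \<open>p\<close>. They are extended by \<open>0\<close> to
  arbitrary functions, so that a tangent vector is determined by its action on \<open>C\<^sup>\<infinity>(M)\<close>. The
  derivation rule makes the value on \<open>h\<close> depend only on the restriction of \<open>h\<close> to \<open>M\<close>.\<close>

type_synonym 'a tvec = "('a \<Rightarrow> real) \<Rightarrow> real"
type_synonym 'a vfield = "'a \<Rightarrow> 'a tvec"

definition tzero :: "'a tvec" where
  "tzero = (\<lambda>h. 0)"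

definition tadd :: "'a tvec \<Rightarrow> 'a tvec \<Rightarrow> 'a tvec" where
  "tadd u v = (\<lambda>h. u h + v h)"

definition tscale :: "real \<Rightarrow> 'a tvec \<Rightarrow> 'a tvec" where
  "tscale c v = (\<lambda>h. c * v h)"

definition tangent_space :: "('a, 'e::euclidean_space) manifold \<Rightarrow> 'a \<Rightarrow> 'a tvec set" where
  "tangent_space M p =
     {v. (\<forall>h k. smooth_fun M h \<longrightarrow> smooth_fun M k \<longrightarrow> v (\<lambda>x. h x + k x) = v h + v k) \<and>
         (\<forall>c h. smooth_fun M h \<longrightarrow> v (\<lambda>x. c * h x) = c * v h) \<and>
         (\<forall>h k. smooth_fun M h \<longrightarrow> smooth_fun M k \<longrightarrow>
            v (\<lambda>x. h x * k x) = h p * v k + k p * v h) \<and>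
         (\<forall>h. \<not> smooth_fun M h \<longrightarrow> v h = 0)}"

text \<open>The smooth vector fields on \<open>M\<close>, extended by \<open>0\<close> outside \<open>M\<close>.\<close>

definition vector_fields :: "('a, 'e::euclidean_space) manifold \<Rightarrow> 'a vfield set" where
  "vector_fields M =
     {X. (\<forall>p\<in>points M. X p \<in> tangent_space M p) \<and>
         (\<forall>p. p \<notin> points M \<longrightarrow> X p = tzero) \<and>
         (\<forall>h. smooth_fun M h \<longrightarrow> smooth_fun M (\<lambda>p. X p h))}"

definition vadd :: "'a vfield \<Rightarrow> 'a vfield \<Rightarrow> 'a vfield" where
  "vadd X Y = (\<lambda>p. tadd (X p) (Y p))"

definition vscale :: "('a \<Rightarrow> real) \<Rightarrow> 'a vfield \<Rightarrow> 'a vfield" where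
  "vscale f X = (\<lambda>p. tscale (f p) (X p))"

definition lie_bracket :: "'a vfield \<Rightarrow> 'a vfield \<Rightarrow> 'a vfield" where
  "lie_bracket X Y = (\<lambda>p h. X p (\<lambda>q. Y q h) - Y p (\<lambda>q. X q h))"

definition one_form :: "('a, 'e::euclidean_space) manifold \<Rightarrow> ('a \<Rightarrow> 'a tvec \<Rightarrow> real) \<Rightarrow> bool" where
  "one_form M \<omega> \<longleftrightarrow>
     (\<forall>p\<in>points M. \<forall>u\<in>tangent_space M p. \<forall>v\<in>tangent_space M p. \<forall>c.
        \<omega> p (tadd u v) = \<omega> p u + \<omega> p v \<and> \<omega> p (tscale c u) = c * \<omega> p u) \<and>
     (\<forall>X\<in>vector_fields M. smooth_fun M (\<lambda>p. \<omega> p (X p)))"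


section \<open>Riemannian metrics and the Levi-Civita connection\<close>

definition riemannian_metric ::
    "('a, 'e::euclidean_space) manifold \<Rightarrow> ('a \<Rightarrow> 'a tvec \<Rightarrow> 'a tvec \<Rightarrow> real) \<Rightarrow> bool" where
  "riemannian_metric M g \<longleftrightarrow>
     (\<forall>p\<in>points M. \<forall>u\<in>tangent_space M p. \<forall>v\<in>tangent_space M p.
        g p u v = g p v u \<and>
        (\<forall>w\<in>tangent_space M p. g p (tadd u v) w = g p u w + g p v w) \<and>
        (\<forall>c. g p (tscale c u) v = c * g p u v) \<and>
        (u \<noteq> tzero \<longrightarrow> g p u u > 0)) \<and>
     (\<forall>X\<in>vector_fields M. \<forall>Y\<in>vector_fields M. smooth_fun M (\<lambda>p. g p (X p) (Y p)))"

definition riemannian_manifold ::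
    "('a, 'e::euclidean_space) manifold \<Rightarrow> ('a \<Rightarrow> 'a tvec \<Rightarrow> 'a tvec \<Rightarrow> real) \<Rightarrow> bool" where
  "riemannian_manifold M g \<longleftrightarrow> smooth_manifold M \<and> riemannian_metric M g"

text \<open>In the following \<open>D X Y\<close> stands for \<open>\<nabla>\<^sub>X Y\<close>; only its values on smooth vector fields matter.\<close>

definition affine_connection ::
    "('a, 'e::euclidean_space) manifold \<Rightarrow> ('a vfield \<Rightarrow> 'a vfield \<Rightarrow> 'a vfield) \<Rightarrow> bool" where
  "affine_connection M D \<longleftrightarrow>
     (\<forall>X\<in>vector_fields M. \<forall>Y\<in>vector_fields M.
        D X Y \<in> vector_fields M \<and>
        (\<forall>Z\<in>vector_fields M.
           D (vadd X Z) Y = vadd (D X Y) (D Z Y) \<and>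
           D X (vadd Y Z) = vadd (D X Y) (D X Z)) \<and>
        (\<forall>h. smooth_fun M h \<longrightarrow>
           D (vscale h X) Y = vscale h (D X Y) \<and>
           D X (vscale h Y) = vadd (vscale h (D X Y)) (vscale (\<lambda>p. X p h) Y)))"

definition torsion_free ::
    "('a, 'e::euclidean_space) manifold \<Rightarrow> ('a vfield \<Rightarrow> 'a vfield \<Rightarrow> 'a vfield) \<Rightarrow> bool" where
  "torsion_free M D \<longleftrightarrow>
     (\<forall>X\<in>vector_fields M. \<forall>Y\<in>vector_fields M.
        D X Y = vadd (D Y X) (lie_bracket X Y))"

definition metric_compatible ::
    "('a, 'e::euclidean_space) manifold \<Rightarrow> ('a \<Rightarrow> 'a tvec \<Rightarrow> 'a tvec \<Rightarrow> real) \<Rightarrow>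
     ('a vfield \<Rightarrow> 'a vfield \<Rightarrow> 'a vfield) \<Rightarrow> bool" where
  "metric_compatible M g D \<longleftrightarrow>
     (\<forall>X\<in>vector_fields M. \<forall>Y\<in>vector_fields M. \<forall>Z\<in>vector_fields M. \<forall>p\<in>points M.
        X p (\<lambda>q. g q (Y q) (Z q)) = g p (D X Y p) (Z p) + g p (Y p) (D X Z p))"

definition levi_civita ::
    "('a, 'e::euclidean_space) manifold \<Rightarrow> ('a \<Rightarrow> 'a tvec \<Rightarrow> 'a tvec \<Rightarrow> real) \<Rightarrow>
     ('a vfield \<Rightarrow> 'a vfield \<Rightarrow> 'a vfield) \<Rightarrow> bool" where
  "levi_civita M g D \<longleftrightarrow> affine_connection M D \<and> torsion_free M D \<and> metric_compatible M g D"


section \<open>Torse-forming and torqued vector fields\<close>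

text \<open>The conformal scalar \<open>f\<close> and the generating form \<open>\<omega>\<close> are kept as parameters, because being
  proper and being torqued are conditions on these data.\<close>

definition torse_forming ::
    "('a, 'e::euclidean_space) manifold \<Rightarrow> ('a vfield \<Rightarrow> 'a vfield \<Rightarrow> 'a vfield) \<Rightarrow> 'a vfield \<Rightarrow>
     ('a \<Rightarrow> real) \<Rightarrow> ('a \<Rightarrow> 'a tvec \<Rightarrow> real) \<Rightarrow> bool" where
  "torse_forming M D V f \<omega> \<longleftrightarrow>
     V \<in> vector_fields M \<and> (\<forall>p\<in>points M. V p \<noteq> tzero) \<and>
     smooth_fun M f \<and> one_form M \<omega> \<and>
     (\<forall>X\<in>vector_fields M. D X V = vadd (vscale f X) (vscale (\<lambda>p. \<omega> p (X p)) V))"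

definition proper_torse_forming ::
    "('a, 'e::euclidean_space) manifold \<Rightarrow> ('a vfield \<Rightarrow> 'a vfield \<Rightarrow> 'a vfield) \<Rightarrow> 'a vfield \<Rightarrow>
     ('a \<Rightarrow> real) \<Rightarrow> ('a \<Rightarrow> 'a tvec \<Rightarrow> real) \<Rightarrow> bool" where
  "proper_torse_forming M D V f \<omega> \<longleftrightarrow>
     torse_forming M D V f \<omega> \<and>
     (\<forall>U. openin (mtop M) U \<longrightarrow> U \<noteq> {} \<longrightarrow>
        \<not> (\<forall>p\<in>U. f p = 0) \<and> \<not> (\<forall>p\<in>U. \<forall>v\<in>tangent_space M p. \<omega> p v = 0))"

definition torqued ::
    "('a, 'e::euclidean_space) manifold \<Rightarrow> ('a vfield \<Rightarrow> 'a vfield \<Rightarrow> 'a vfield) \<Rightarrow> 'a vfield \<Rightarrow>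
     ('a \<Rightarrow> real) \<Rightarrow> ('a \<Rightarrow> 'a tvec \<Rightarrow> real) \<Rightarrow> bool" where
  "torqued M D V f \<omega> \<longleftrightarrow> torse_forming M D V f \<omega> \<and> (\<forall>p\<in>points M. \<omega> p (V p) = 0)"

end

theory Submission
  imports Defs
begin

text \<open>If \<open>|V|\<close> is constant, then \<open>0 = V\<langle>V, V\<rangle> = 2\<langle>\<nabla>\<^sub>V V, V\<rangle> = 2 f |V|\<^sup>2\<close>, because the torqued
  condition \<open>\<omega>(V) = 0\<close> removes the second term of \<open>\<nabla>\<^sub>V V\<close>. Hence \<open>f = 0\<close> on all of \<open>M\<close>,
  which contradicts properness.\<close>

text \<open>Openness of \<open>S\<close> makes the derivative at a point of \<open>S\<close> depend
  on \<open>f\<close> inside \<open>S\<close> only. It is 0 there, so the induction hypothesis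
  applies to it with \<open>c = 0\<close>; hence \<open>f\<close> and \<open>c\<close> are arbitrary
  in the induction.\<close>

lemma Ck_on_constant:
  fixes f :: "'e::euclidean_space \<Rightarrow> 'b::real_normed_vector"
  assumes "open S" and "\<And>x. x \<in> S \<Longrightarrow> f x = c"
  shows "Ck_on k S f"
  using assms(2)
proof (induction k arbitrary: f c)
  case 0
  then show ?case by (simp cong: continuous_on_cong)
next
  case (Suc k)
  have der: "(f has_derivative (\<lambda>v. 0)) (at x)" if "x \<in> S" for x
    by (rule has_derivative_transform_within_open[OF has_derivative_const \<open>open S\<close> that])
      (simp add: Suc.prems)
  have "frechet_derivative f (at x) v = 0" if "x \<in> S" for x v
    using frechet_derivative_at[OF der[OF that]] by metis
  then show ?case
    using der Suc.IH by (auto simp: differentiable_def)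
qed

text \<open>Chart domains lie in \<open>M\<close>, so the function reads as the constant 1 in every
  chart. It is the unit of the smooth functions that also erases values outside
  \<open>M\<close>.\<close>

lemma smooth_fun_indicator_points:
  fixes M :: "('a, 'e::euclidean_space) manifold"
  assumes "smooth_manifold M"
  shows "smooth_fun M (indicator (points M))"
  unfolding smooth_fun_def smooth_on_def
proof (clarify)
  fix U and \<phi> :: "'a \<Rightarrow> 'e" and k
  assume "(U, \<phi>) \<in> atlas M"
  then have "is_chart (mtop M) U \<phi>"
    using assms by (auto simp: smooth_manifold_def)
  then have opn: "open (\<phi> ` U)" and U: "U \<subseteq> points M"
    by (auto simp: is_chart_def openin_subset)
  have "indicator (points M) (inv_into U \<phi> z) = (1::real)" if "z \<in> \<phi> ` U" for z
    using inv_into_into[OF that] U by auto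
  then show "Ck_on k (\<phi> ` U) (\<lambda>z. indicator (points M) (inv_into U \<phi> z) :: real)"
    by (rule Ck_on_constant[OF opn])
qed

text \<open>The values of \<open>h\<close> outside \<open>M\<close> are arbitrary, so \<open>h\<close> need not be a constant function. The
  indicator \<open>e\<close> of \<open>M\<close> absorbs them: \<open>e h = c e\<close> holds everywhere.\<close>

lemma tangent_vector_constant:
  assumes "smooth_manifold M" and "p \<in> points M" and v: "v \<in> tangent_space M p"
    and h: "smooth_fun M h" and const: "\<And>q. q \<in> points M \<Longrightarrow> h q = c"
  shows "v h = 0"
proof -
  let ?e = "indicator (points M) :: _ \<Rightarrow> real"
  have e: "smooth_fun M ?e"
    using assms(1) by (rule smooth_fun_indicator_points)
  have "(\<lambda>q. ?e q * h q) = (\<lambda>q. c * ?e q)"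
    using const by (auto simp: indicator_def)
  moreover have "v (\<lambda>q. ?e q * h q) = ?e p * v h + h p * v ?e"
    and "v (\<lambda>q. c * ?e q) = c * v ?e"
    using v e h by (auto simp: tangent_space_def)
  \<comment> \<open>At \<open>p\<close> the two expansions read
    \<open>v h + c * v ?e = c * v ?e\<close>, so the value of \<open>v ?e\<close> cancels.\<close>
  ultimately show ?thesis
    using const \<open>p \<in> points M\<close> by simp
qed

lemma torqued_derivative_length:
  fixes M :: "('a, 'e::euclidean_space) manifold"
  assumes "riemannian_manifold M g" and "levi_civita M g D" and "torqued M D V f \<omega>"
    and p: "p \<in> points M"
  shows "V p (\<lambda>q. g q (V q) (V q)) = 2 * f p * g p (V p) (V p)"
proof -
  have V: "V \<in> vector_fields M"
    using assms(3) by (simp add: torqued_def torse_forming_def)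
  have Vp: "V p \<in> tangent_space M p"
    using V p by (simp add: vector_fields_def)
  \<comment> \<open>Symmetry of \<open>g p\<close> is given on tangent vectors only, so
    \<open>D V V p\<close> must be known to be one.\<close>
  have "D V V \<in> vector_fields M"
    using assms(2) V by (simp add: levi_civita_def affine_connection_def)
  then have Dp: "D V V p \<in> tangent_space M p"
    using p by (simp add: vector_fields_def)
  have "D V V = vadd (vscale f V) (vscale (\<lambda>q. \<omega> q (V q)) V)" and "\<omega> p (V p) = 0"
    using assms(3) V p by (simp_all add: torqued_def torse_forming_def)
  then have DVV: "D V V p = tscale (f p) (V p)"
    by (simp add: vadd_def vscale_def tadd_def tscale_def)
  have g: "riemannian_metric M g"
    using assms(1) by (simp add: riemannian_manifold_def)
  have "V p (\<lambda>q. g q (V q) (V q)) = g p (D V V p) (V p) + g p (V p) (D V V p)"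
    using assms(2) V p by (simp add: levi_civita_def metric_compatible_def)
  also have "g p (V p) (D V V p) = g p (D V V p) (V p)"
    using g p Vp Dp unfolding riemannian_metric_def by blast
  also have "g p (D V V p) (V p) = f p * g p (V p) (V p)"
    unfolding DVV using g p Vp unfolding riemannian_metric_def by blast
  finally show ?thesis by simp
qed

theorem proposition3p2:
  fixes M :: "('a, 'e::euclidean_space) manifold"
    and g :: "'a \<Rightarrow> 'a tvec \<Rightarrow> 'a tvec \<Rightarrow> real"
    and D :: "'a vfield \<Rightarrow> 'a vfield \<Rightarrow> 'a vfield"
    and V :: "'a vfield"
    and f :: "'a \<Rightarrow> real"
    and \<omega> :: "'a \<Rightarrow> 'a tvec \<Rightarrow> real"
  assumes "riemannian_manifold M g"
    and "levi_civita M g D"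
    and "proper_torse_forming M D V f \<omega>"
    and "torqued M D V f \<omega>"
  shows "\<not> (\<lambda>p. sqrt (g p (V p) (V p))) constant_on points M"
proof
  assume "(\<lambda>p. sqrt (g p (V p) (V p))) constant_on points M"
  then obtain r where r: "\<And>p. p \<in> points M \<Longrightarrow> sqrt (g p (V p) (V p)) = r"
    unfolding constant_on_def by blast
  have g: "riemannian_metric M g" and M: "smooth_manifold M"
    using assms(1) by (simp_all add: riemannian_manifold_def)
  then obtain p0 where p0: "p0 \<in> points M"
    unfolding smooth_manifold_def by blast
  \<comment> \<open>The squared length is used because the metric makes it smooth directly.
    \<open>sqrt\<close> is injective on all reals, so equal roots have equal arguments.\<close>
  have const: "g p (V p) (V p) = g p0 (V p0) (V p0)" if "p \<in> points M" for p
    by (metis r[OF that] r[OF p0] real_sqrt_eq_iff)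
  have V: "V \<in> vector_fields M" and nonzero: "\<And>p. p \<in> points M \<Longrightarrow> V p \<noteq> tzero"
    using assms(4) by (simp_all add: torqued_def torse_forming_def)
  have smooth: "smooth_fun M (\<lambda>p. g p (V p) (V p))"
    using g V unfolding riemannian_metric_def by blast
  have "f p = 0" if p: "p \<in> points M" for p
  proof -
    have Vp: "V p \<in> tangent_space M p"
      using V p by (simp add: vector_fields_def)
    have "V p (\<lambda>q. g q (V q) (V q)) = 0"
      using const by (rule tangent_vector_constant[OF M p Vp smooth])
    \<comment> \<open>This factor can then be cancelled from
      \<open>0 = 2 * f p * g p (V p) (V p)\<close>.\<close>
    moreover have "g p (V p) (V p) > 0"
      using g p Vp nonzero[OF p] unfolding riemannian_metric_def by blast
    ultimately show ?thesis
      using torqued_derivative_length[OF assms(1,2,4) p] by simp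
  qed
  \<comment> \<open>Properness is applied to the open set \<open>points M\<close> itself, nonempty
    by \<open>p0\<close>.\<close>
  moreover have "\<not> (\<forall>p\<in>points M. f p = 0)"
    using assms(3) openin_topspace[of "mtop M"] p0
    unfolding proper_torse_forming_def by (metis empty_iff)
  ultimately show False by simp
qed

end
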